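(* Let $G=(V,E)$ be a finite connected graph with start vertex $s$ and goal vertex $g$, let $n\ge 1$ be the number of objectives, and let each edge $e\in E$ carry a vector of non-negative costs $(f_1(e),\dots,f_n(e))$, with induced path objectives $F_1,\dots,F_n$ on the set $\mathcal{P}_{s,g}$ of simple paths from $s$ to $g$. Fix a weight vector $\mathbf{w}=(w_1,\dots,w_n)\in\mathcal{W}$. Let $P_{\text{WM}}\in\arg\min_{P\in\mathcal{P}_{s,g}}\text{WM}(P)$ be an optimal weighted maximum solution and let $P_{\text{WS}}\in\arg\min_{P\in\mathcal{P}_{s,g}}\text{WS}(P)$ be an optimal weighted sum solution, both for this same $\mathbf{w}$. Then $$\text{WM}(P_{\text{WS}})\;\le\; n\cdot \text{WM}(P_{\text{WM}}).$$
   Context: For a path $P\in\mathcal{P}_{s,g}$ with edges $e_1,\dots,e_k$, the $i$-th objective is $F_i(P)=f_i(e_1)+\dots+f_i(e_k)\in\mathbb{R}_{\ge 0}$, for $i=1,\dots,n$. The weight space is $\mathcal{W}=\{\mathbf{w}\in\mathbb{R}^n_{\ge 0} : \sum_{i=1}^n w_i=1\}$. For a given $\mathbf{w}\in\mathcal{W}$, the weighted sum cost is $\text{WS}(P)=\sum_{i=1}^n w_iF_i(P)$ and the weighted maximum cost is $\text{WM}(P)=\max_{1\le i\le n} w_iF_i(P)$. *)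

theory Defs
  imports "HOL-Analysis.Analysis" "Graph_Theory.Graph_Theory"
begin

text \<open>A finite simple undirected graph is a \<^locale>\<open>pair_graph\<close>: a finite, loop-free, symmetric
  set of arcs, so that each undirected edge between \<open>u\<close> and \<open>v\<close> is represented by the two arcs
  \<open>(u, v)\<close> and \<open>(v, u)\<close>. Costs are attached to the undirected edge \<open>{u, v}\<close> and hence do not depend
  on the direction of traversal.\<close>

definition uedge :: "'v \<times> 'v \<Rightarrow> 'v set" where
  "uedge a = {fst a, snd a}"

definition uedges :: "'v pair_pre_digraph \<Rightarrow> 'v set set" where
  "uedges G = uedge ` parcs G"

definition simple_paths :: "'v pair_pre_digraph \<Rightarrow> 'v \<Rightarrow> 'v \<Rightarrow> ('v \<times> 'v) list set" where
  "simple_paths G s g = {P. pre_digraph.apath (with_proj G) s P g}"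

definition path_cost :: "('v set \<Rightarrow> real ^ 'n) \<Rightarrow> ('v \<times> 'v) list \<Rightarrow> real ^ 'n" where
  "path_cost f P = (\<Sum>a\<leftarrow>P. f (uedge a))"

definition weight_space :: "(real ^ 'n) set" where
  "weight_space = {w. (\<forall>i. 0 \<le> w $ i) \<and> (\<Sum>i\<in>UNIV. w $ i) = 1}"

definition WS :: "('v set \<Rightarrow> real ^ 'n) \<Rightarrow> real ^ 'n \<Rightarrow> ('v \<times> 'v) list \<Rightarrow> real" where
  "WS f w P = (\<Sum>i\<in>UNIV. w $ i * path_cost f P $ i)"

definition WM :: "('v set \<Rightarrow> real ^ 'n) \<Rightarrow> real ^ 'n \<Rightarrow> ('v \<times> 'v) list \<Rightarrow> real" where
  "WM f w P = Max (range (\<lambda>i. w $ i * path_cost f P $ i))"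

end

theory Submission
  imports Defs
begin

text \<open>For a fixed path, \<open>WM\<close> and \<open>WS\<close> are the max-norm and the
  1-norm of the non-negative vector of weighted objectives, so WM \<le> WS \<le> n * WM
  (\<open>WM_le_WS\<close>, \<open>WS_le_card_WM\<close>). Passing from \<open>WM\<close> to
  \<open>WS\<close> at \<open>P_WS\<close>, using optimality there, and returning to
  \<open>WM\<close> at \<open>P_WM\<close> costs one factor n.\<close>

lemma path_cost_nonneg:
  assumes nn: "\<And>e i. e \<in> uedges G \<Longrightarrow> 0 \<le> f e $ i" and P: "P \<in> simple_paths G s g"
  shows "0 \<le> path_cost f P $ i"
proof -
  \<comment> \<open>Costs are controlled only on edges of \<open>G\<close>. Containment of the arcs
    in \<open>G\<close>, unlike being a path from \<open>s\<close> to \<open>g\<close>, passes to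
    the tail of the list, which the induction requires.\<close>
  have "set P \<subseteq> parcs G"
    using P unfolding simple_paths_def pre_digraph.apath_def pre_digraph.awalk_def by simp
  then show ?thesis
    unfolding path_cost_def
  proof (induction P)
    case (Cons a P)
    then have "uedge a \<in> uedges G" by (auto simp: uedges_def)
    with Cons nn show ?case by simp
  qed simp
qed

text \<open>The factor n arises here: it counts the summands, each bounded by the largest.\<close>

lemma WS_le_card_WM:
  fixes f :: "'v set \<Rightarrow> real ^ 'n"
  shows "WS f w P \<le> real CARD('n) * WM f w P"
  unfolding WS_def WM_def by (rule sum_bounded_above) (simp add: Max_ge)

text \<open>Signs matter here: with all summands non-negative, none of them can exceed the
  total.\<close>

lemma WM_le_WS:
  assumes "\<And>i. 0 \<le> w $ i" and "\<And>i. 0 \<le> path_cost f P $ i"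
  shows "WM f w P \<le> WS f w P"
  unfolding WM_def
proof (rule Max.boundedI; clarsimp)
  fix i
  show "w $ i * path_cost f P $ i \<le> WS f w P"
    unfolding WS_def
    by (rule member_le_sum[where f = "\<lambda>i. w $ i * path_cost f P $ i"]) (simp_all add: assms)
qed

theorem proposition2:
  fixes G :: "'v pair_pre_digraph"
    and s g :: 'v
    and f :: "'v set \<Rightarrow> real ^ 'n"
    and w :: "real ^ 'n"
    and P_WM P_WS :: "('v \<times> 'v) list"
  assumes "pair_graph G"
    and "Digraph_Component.connected (with_proj G)"
    and "s \<in> pverts G" and "g \<in> pverts G"
    and "\<And>e i. e \<in> uedges G \<Longrightarrow> 0 \<le> f e $ i"
    and "w \<in> weight_space"
    and "is_arg_min (WM f w) (\<lambda>P. P \<in> simple_paths G s g) P_WM"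
    and "is_arg_min (WS f w) (\<lambda>P. P \<in> simple_paths G s g) P_WS"
  shows "WM f w P_WS \<le> real CARD('n) * WM f w P_WM"
proof -
  have paths: "P_WM \<in> simple_paths G s g" "P_WS \<in> simple_paths G s g"
    using assms(7,8) by (auto simp: is_arg_min_def)
  have "WM f w P_WS \<le> WS f w P_WS"
  proof (rule WM_le_WS)
    show "0 \<le> w $ i" for i
      using assms(6) by (simp add: weight_space_def)
    show "0 \<le> path_cost f P_WS $ i" for i
      using assms(5) paths(2) by (rule path_cost_nonneg)
  qed
  \<comment> \<open>\<open>P_WM\<close> is a competitor in the minimisation of
    \<open>WS\<close>.\<close>
  also have "\<dots> \<le> WS f w P_WM"
    using assms(8) paths(1) by (auto simp: is_arg_min_linorder)
  also have "\<dots> \<le> real CARD('n) * WM f w P_WM"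
    by (rule WS_le_card_WM)
  finally show ?thesis .
qed

end
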